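(* Let $(\psi^n, A^n)_{n\ge 0}$ be a solution of the semi-discrete scheme $$\frac{\psi^n-\psi^{n-1}}{\tau}+\Big(\frac{i}{\kappa}\nabla+A^{n-1}\Big)^2\psi^n+f(|\psi^{n-1}|^2)\psi^n+S(\psi^n-\psi^{n-1})=0,$$ $$\sigma\frac{A^n-A^{n-1}}{\tau}+\operatorname{curl}\operatorname{curl}A^n+\frac1\kappa\operatorname{Im}\big(\psi^n\nabla\overline{\psi^n}\big)+A^n|\psi^n|^2=\operatorname{curl}H^n,$$ in $\Omega$ for $n=1,2,3,\dots$, with the boundary conditions stated in the context, and with initial value $\psi^0=\psi_0$. Here $f$ is the function defined in the context, which is assumed to satisfy $f(1)=0$. Assume that $|f'|\le L$ for some positive constant $L$. If $S\ge 2L$ and $|\psi_0|\le 1$ in $\overline\Omega$, then $|\psi^n|\le 1$ in $\overline\Omega$ for all $n$.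
   Context: $\Omega\subset\mathbb R^d$ ($d=2,3$) is a bounded domain with smooth boundary and unit outer normal $n$ (the letter $n$ is also used for the time index; a dot or cross product with $n$ always refers to the normal). The constants $\kappa,\sigma,\tau>0$ are the Ginzburg–Landau parameter, a relaxation parameter and the time step, $t^n=n\tau$, and $S$ is a real stabilization constant. The unknowns are $\psi^n:\overline\Omega\to\mathbb C$ (order parameter) and $A^n:\overline\Omega\to\mathbb R^d$ (magnetic potential); $H^n=H(\cdot,t^n)$ is a given external magnetic field. The initial data are $(\psi^0,A^0)$. All functions are assumed smooth up to the boundary, so that equations and boundary conditions hold pointwise. A bar denotes complex conjugation, and $(\frac{i}{\kappa}\nabla+A)^2\psi=-\frac1{\kappa^2}\Delta\psi+\frac{i}{\kappa}(\operatorname{div}A)\psi+\frac{2i}{\kappa}A\cdot\nabla\psi+|A|^2\psi$. The electric potential is zero. For $d=2$ the usual convention is used: $\operatorname{curl}A=\partial_1A_2-\partial_2A_1$ is scalar, $H$ is scalar, and $\operatorname{curl}H=(\partial_2H,-\partial_1H)$; the condition $n\times\operatorname{curl}A=n\times H$ then means $\operatorname{curl}A=H$ on $\partial\Omega$. Boundary conditions on $\partial\Omega$: $\nabla\psi^m\cdot n=0$ and $n\times\operatorname{curl}A^m=n\times H^m$ for all $m\ge1$, and $A^m\cdot n=0$ for all $m\ge0$. The nonlinearity is, for $s\ge 0$, $$f(s)=1-\int_0^{\tilde\omega}\frac{\nu_0}{4\sqrt{\xi^2+s}}\sum_{\pm}\tanh\big(\beta(\sqrt{\xi^2+s}\pm\delta)\big)\,d\xi,$$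 where $\tilde\omega,\beta>0$ are constants, $\delta=\delta(x)$ is a given smooth real-valued function on $\overline\Omega$ (so $f$ may also depend on $x$; the conditions $f(1)=0$ and $|f'|\le L$ are meant at every $x$), and the constant $\nu_0$ is determined by $\nu_0\int_0^{\tilde\omega}\frac{\tanh(\beta_0\xi)}{2\xi}\,d\xi=1$ for a given constant $\beta_0>0$. $f'$ is the derivative with respect to $s$, and $|f'|\le L$ means $|f'(s)|\le L$ for all $s\ge0$. *)

theory Defs
  imports "HOL-Analysis.Analysis"
begin

section \<open>Smoothness up to the boundary\<close>

text \<open>Derivatives are taken within a set \<open>K\<close>, which is always an open set or the closure of a
  smooth domain; in both cases the derivative within \<open>K\<close> is unique at every point of \<open>K\<close>.
  Values of a function outside \<open>K\<close> are therefore irrelevant. At boundary points the derivative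
  within \<open>K\<close> is the continuous extension of the interior one, so for the closure of a smooth
  domain \<open>smooth_on K\<close> is the usual class of functions all of whose derivatives extend
  continuously to the closure.\<close>

definition partial ::
  "(real^'d) set \<Rightarrow> 'd::finite \<Rightarrow> (real^'d \<Rightarrow> 'b::real_normed_vector) \<Rightarrow> real^'d \<Rightarrow> 'b" where
  "partial K i u x = frechet_derivative u (at x within K) (axis i 1)"

primrec Ck_on ::
  "nat \<Rightarrow> (real^'d::finite) set \<Rightarrow> (real^'d \<Rightarrow> 'b::real_normed_vector) \<Rightarrow> bool" where
  "Ck_on 0 K u \<longleftrightarrow> continuous_on K u"
| "Ck_on (Suc k) K u \<longleftrightarrow> u differentiable_on K \<and> (\<forall>i. Ck_on k K (partial K i u))"

definition smooth_on ::
  "(real^'d::finite) set \<Rightarrow> (real^'d \<Rightarrow> 'b::real_normed_vector) \<Rightarrow> bool" where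
  "smooth_on K u \<longleftrightarrow> (\<forall>k. Ck_on k K u)"

section \<open>Differential operators\<close>

definition gradient :: "(real^'d::finite) set \<Rightarrow> (real^'d \<Rightarrow> 'b) \<Rightarrow> real^'d \<Rightarrow> 'b::real_normed_vector^'d" where
  "gradient K u x = (\<chi> i. partial K i u x)"

definition divergence :: "(real^'d::finite) set \<Rightarrow> (real^'d \<Rightarrow> real^'d) \<Rightarrow> real^'d \<Rightarrow> real" where
  "divergence K A x = (\<Sum>i\<in>UNIV. partial K i A x $ i)"

definition laplacian ::
  "(real^'d::finite) set \<Rightarrow> (real^'d \<Rightarrow> 'b::real_normed_vector) \<Rightarrow> real^'d \<Rightarrow> 'b" where
  "laplacian K u x = (\<Sum>i\<in>UNIV. partial K i (partial K i u) x)"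

definition rcdot :: "real^'d::finite \<Rightarrow> complex^'d \<Rightarrow> complex" where
  "rcdot a z = (\<Sum>i\<in>UNIV. of_real (a $ i) * z $ i)"

definition curl3 :: "(real^3) set \<Rightarrow> (real^3 \<Rightarrow> real^3) \<Rightarrow> real^3 \<Rightarrow> real^3" where
  "curl3 K A x = vector [partial K 2 A x $ 3 - partial K 3 A x $ 2,
                         partial K 3 A x $ 1 - partial K 1 A x $ 3,
                         partial K 1 A x $ 2 - partial K 2 A x $ 1]"

definition curl2 :: "(real^2) set \<Rightarrow> (real^2 \<Rightarrow> real^2) \<Rightarrow> real^2 \<Rightarrow> real" where
  "curl2 K A x = partial K 1 A x $ 2 - partial K 2 A x $ 1"

definition curl2_scalar :: "(real^2) set \<Rightarrow> (real^2 \<Rightarrow> real) \<Rightarrow> real^2 \<Rightarrow> real^2" where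
  "curl2_scalar K h x = vector [partial K 2 h x, - partial K 1 h x]"

text \<open>The operator \<open>(i/\<kappa> \<nabla> + A)\<^sup>2\<close> applied to \<open>\<psi>\<close>.\<close>

definition magnetic_laplacian ::
  "real \<Rightarrow> (real^'d::finite) set \<Rightarrow> (real^'d \<Rightarrow> real^'d) \<Rightarrow> (real^'d \<Rightarrow> complex) \<Rightarrow> real^'d \<Rightarrow> complex" where
  "magnetic_laplacian \<kappa> K A \<psi> x =
     - (1 / of_real (\<kappa>\<^sup>2)) * laplacian K \<psi> x
     + \<i> / of_real \<kappa> * of_real (divergence K A x) * \<psi> x
     + 2 * \<i> / of_real \<kappa> * rcdot (A x) (gradient K \<psi> x)
     + of_real ((norm (A x))\<^sup>2) * \<psi> x"

section \<open>Smooth domains\<close>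

definition local_defining_function ::
  "(real^'d::finite) set \<Rightarrow> real^'d \<Rightarrow> (real^'d) set \<Rightarrow> (real^'d \<Rightarrow> real) \<Rightarrow> bool" where
  "local_defining_function \<Omega> p U \<rho> \<longleftrightarrow>
     open U \<and> p \<in> U \<and> smooth_on U \<rho> \<and> (\<forall>x\<in>U. gradient U \<rho> x \<noteq> 0) \<and>
     \<Omega> \<inter> U = {x \<in> U. \<rho> x < 0}"

definition smooth_bounded_domain :: "(real^'d::finite) set \<Rightarrow> bool" where
  "smooth_bounded_domain \<Omega> \<longleftrightarrow>
     \<Omega> \<noteq> {} \<and> open \<Omega> \<and> connected \<Omega> \<and> bounded \<Omega> \<and>
     (\<forall>p\<in>frontier \<Omega>. \<exists>U \<rho>. local_defining_function \<Omega> p U \<rho>)"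

text \<open>The direction of the gradient at \<open>p\<close> does not depend on the choice of \<open>\<rho>\<close>.\<close>

definition unit_outer_normal :: "(real^'d::finite) set \<Rightarrow> (real^'d \<Rightarrow> real^'d) \<Rightarrow> bool" where
  "unit_outer_normal \<Omega> \<nu> \<longleftrightarrow>
     (\<forall>p\<in>frontier \<Omega>. \<exists>U \<rho>. local_defining_function \<Omega> p U \<rho> \<and> \<nu> p = sgn (gradient U \<rho> p))"

section \<open>The nonlinearity\<close>

text \<open>The argument \<open>d\<close> is the value \<open>\<delta>(x)\<close>. For \<open>s = 0\<close> the integrand has a removable singularity at
  \<open>\<xi> = 0\<close>, where Isabelle's value is 0; this does not affect the integral.\<close>

definition gl_f :: "real \<Rightarrow> real \<Rightarrow> real \<Rightarrow> real \<Rightarrow> real \<Rightarrow> real" where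
  "gl_f \<nu>0 \<omega> \<beta> d s =
     1 - integral {0..\<omega>} (\<lambda>\<xi>. \<nu>0 / (4 * sqrt (\<xi>\<^sup>2 + s)) *
           (tanh (\<beta> * (sqrt (\<xi>\<^sup>2 + s) + d)) + tanh (\<beta> * (sqrt (\<xi>\<^sup>2 + s) - d))))"

text \<open>At \<open>s = 0\<close> the derivative is one-sided, since \<open>f\<close> is only considered for \<open>s \<ge> 0\<close>.\<close>

definition derivative_bounded :: "(real \<Rightarrow> real) \<Rightarrow> real \<Rightarrow> bool" where
  "derivative_bounded g L \<longleftrightarrow>
     (\<forall>s\<ge>0. \<exists>D. (g has_real_derivative D) (at s within {0..}) \<and> \<bar>D\<bar> \<le> L)"

section \<open>The semi-discrete scheme\<close>

text \<open>In the following, \<open>f x s\<close> is the nonlinearity, and \<open>H x t\<close> the external magnetic field.\<close>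

definition psi_scheme ::
  "(real^'d::finite) set \<Rightarrow> (real^'d \<Rightarrow> real^'d) \<Rightarrow> real \<Rightarrow> real \<Rightarrow> real \<Rightarrow> (real^'d \<Rightarrow> real \<Rightarrow> real) \<Rightarrow>
   (nat \<Rightarrow> real^'d \<Rightarrow> complex) \<Rightarrow> (nat \<Rightarrow> real^'d \<Rightarrow> real^'d) \<Rightarrow> bool" where
  "psi_scheme \<Omega> \<nu> \<kappa> \<tau> S f \<psi> A \<longleftrightarrow>
     (\<forall>n. smooth_on (closure \<Omega>) (\<psi> n)) \<and>
     (\<forall>n\<ge>1. \<forall>x\<in>\<Omega>.
        (\<psi> n x - \<psi> (n - 1) x) / of_real \<tau>
        + magnetic_laplacian \<kappa> (closure \<Omega>) (A (n - 1)) (\<psi> n) x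
        + of_real (f x ((norm (\<psi> (n - 1) x))\<^sup>2)) * \<psi> n x
        + of_real S * (\<psi> n x - \<psi> (n - 1) x) = 0) \<and>
     (\<forall>n\<ge>1. \<forall>x\<in>frontier \<Omega>. rcdot (\<nu> x) (gradient (closure \<Omega>) (\<psi> n) x) = 0)"

definition supercurrent ::
  "real \<Rightarrow> (real^'d::finite) set \<Rightarrow> (real^'d \<Rightarrow> complex) \<Rightarrow> real^'d \<Rightarrow> real^'d" where
  "supercurrent \<kappa> K \<psi> x =
     (1 / \<kappa>) *\<^sub>R (\<chi> i. Im (\<psi> x * gradient K (\<lambda>y. cnj (\<psi> y)) x $ i))"

definition A_scheme_3d ::
  "(real^3) set \<Rightarrow> (real^3 \<Rightarrow> real^3) \<Rightarrow> real \<Rightarrow> real \<Rightarrow> real \<Rightarrow> (real^3 \<Rightarrow> real \<Rightarrow> real^3) \<Rightarrow>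
   (nat \<Rightarrow> real^3 \<Rightarrow> complex) \<Rightarrow> (nat \<Rightarrow> real^3 \<Rightarrow> real^3) \<Rightarrow> bool" where
  "A_scheme_3d \<Omega> \<nu> \<kappa> \<sigma> \<tau> H \<psi> A \<longleftrightarrow>
     (\<forall>n. smooth_on (closure \<Omega>) (A n)) \<and>
     (\<forall>n\<ge>1. smooth_on (closure \<Omega>) (\<lambda>y. H y (real n * \<tau>))) \<and>
     (\<forall>n\<ge>1. \<forall>x\<in>\<Omega>.
        (\<sigma> / \<tau>) *\<^sub>R (A n x - A (n - 1) x)
        + curl3 (closure \<Omega>) (curl3 (closure \<Omega>) (A n)) x
        + supercurrent \<kappa> (closure \<Omega>) (\<psi> n) x
        + (norm (\<psi> n x))\<^sup>2 *\<^sub>R A n x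
        = curl3 (closure \<Omega>) (\<lambda>y. H y (real n * \<tau>)) x) \<and>
     (\<forall>n\<ge>1. \<forall>x\<in>frontier \<Omega>.
        cross3 (\<nu> x) (curl3 (closure \<Omega>) (A n) x) = cross3 (\<nu> x) (H x (real n * \<tau>))) \<and>
     (\<forall>n. \<forall>x\<in>frontier \<Omega>. A n x \<bullet> \<nu> x = 0)"

text \<open>For \<open>d = 2\<close> the fields \<open>curl A\<close> and \<open>H\<close> are scalar, and the tangential condition on \<open>curl A\<close>
  is by convention their equality on the boundary.\<close>

definition A_scheme_2d ::
  "(real^2) set \<Rightarrow> (real^2 \<Rightarrow> real^2) \<Rightarrow> real \<Rightarrow> real \<Rightarrow> real \<Rightarrow> (real^2 \<Rightarrow> real \<Rightarrow> real) \<Rightarrow>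
   (nat \<Rightarrow> real^2 \<Rightarrow> complex) \<Rightarrow> (nat \<Rightarrow> real^2 \<Rightarrow> real^2) \<Rightarrow> bool" where
  "A_scheme_2d \<Omega> \<nu> \<kappa> \<sigma> \<tau> H \<psi> A \<longleftrightarrow>
     (\<forall>n. smooth_on (closure \<Omega>) (A n)) \<and>
     (\<forall>n\<ge>1. smooth_on (closure \<Omega>) (\<lambda>y. H y (real n * \<tau>))) \<and>
     (\<forall>n\<ge>1. \<forall>x\<in>\<Omega>.
        (\<sigma> / \<tau>) *\<^sub>R (A n x - A (n - 1) x)
        + curl2_scalar (closure \<Omega>) (curl2 (closure \<Omega>) (A n)) x
        + supercurrent \<kappa> (closure \<Omega>) (\<psi> n) x
        + (norm (\<psi> n x))\<^sup>2 *\<^sub>R A n x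
        = curl2_scalar (closure \<Omega>) (\<lambda>y. H y (real n * \<tau>)) x) \<and>
     (\<forall>n\<ge>1. \<forall>x\<in>frontier \<Omega>. curl2 (closure \<Omega>) (A n) x = H x (real n * \<tau>)) \<and>
     (\<forall>n. \<forall>x\<in>frontier \<Omega>. A n x \<bullet> \<nu> x = 0)"

end

theory Submission
  imports Defs
begin

text \<open>Multiplying the equation for \<open>\<psi>\<^sup>n\<close> by \<open>cnj \<psi>\<^sup>n\<close> and taking real parts gives an elliptic
  inequality for \<open>u = |\<psi>\<^sup>n|\<^sup>2\<close>, because the first-order terms complete the square
  \<open>|i/\<kappa> \<nabla>\<psi> + A \<psi>|\<^sup>2\<close>. Suppose the maximum of \<open>u\<close> over the closure exceeds 1. At a boundary maximum the
  Neumann condition makes the whole gradient of \<open>u\<close> vanish, so that the second-order test along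
  rays into the domain, and then continuity and evenness of the Hessian form, still yield a
  nonpositive Hessian; no Hopf lemma is needed. The inequality, extended to the closure by
  continuity, is then contradicted by \<open>f(a\<^sup>2) \<ge> - 2 L (1 - a) \<ge> - S (1 - a)\<close> for
  \<open>a = |\<psi>\<^sup>n\<^sup>-\<^sup>1| \<le> 1\<close>.\<close>

section \<open>Derivatives along rays\<close>

text \<open>Encoded through \<open>partial\<close>, so that continuity in \<open>v\<close> and
  differentiation along a ray term by term are immediate; \<open>has_derivative_directional\<close>
  identifies it with the derivative within \<open>K\<close>.\<close>

definition directional ::
  "(real^'d::finite) set \<Rightarrow> (real^'d \<Rightarrow> 'b::real_normed_vector) \<Rightarrow> real^'d \<Rightarrow> real^'d \<Rightarrow> 'b" where
  "directional K u x v = (\<Sum>i\<in>UNIV. v $ i *\<^sub>R partial K i u x)"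

lemma has_derivative_directional:
  assumes "u differentiable_on K" and "x \<in> K"
  shows "(u has_derivative directional K u x) (at x within K)"
proof -
  let ?D = "frechet_derivative u (at x within K)"
  have D: "(u has_derivative ?D) (at x within K)"
    using assms by (simp add: differentiable_on_def frechet_derivative_works)
  interpret linear ?D
    using D by (rule has_derivative_linear)
  have "?D v = directional K u x v" for v
  proof -
    have "?D v = ?D (\<Sum>i\<in>UNIV. v $ i *\<^sub>R axis i 1)"
      using basis_expansion[of v] by (simp add: scalar_mult_eq_scaleR)
    then show ?thesis
      by (simp add: sum scaleR directional_def partial_def)
  qed
  then have "?D = directional K u x"
    by blast
  with D show ?thesis
    by simp
qed

lemma directional_linear:
  assumes "u differentiable_on K" and "x \<in> K"
  shows "linear (directional K u x)"
  using has_derivative_directional[OF assms] by (rule has_derivative_linear)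

lemma sum_axis_scaleR:
  fixes F :: "'d::finite \<Rightarrow> 'b::real_vector"
  shows "(\<Sum>i\<in>UNIV. axis k (1::real) $ i *\<^sub>R F i) = F k"
proof -
  have "axis k (1::real) $ i *\<^sub>R F i = (if i = k then F i else 0)" for i
    by (simp add: axis_def)
  then show ?thesis
    by simp
qed

lemma directional_axis: "directional K u x (axis k 1) = partial K k u x"
  by (simp add: directional_def sum_axis_scaleR)

lemma continuous_on_directional:
  "continuous_on UNIV (\<lambda>v. directional K u x v)"
  unfolding directional_def by (intro continuous_intros)

text \<open>Chain rule on a segment that only has to stay in \<open>K\<close>. The starting point
  may lie on the boundary, hence the derivative within \<open>{0..e}\<close>.\<close>

lemma has_vector_derivative_ray:
  assumes "u differentiable_on K" and ray: "\<And>t. t \<in> {0..e} \<Longrightarrow> x + t *\<^sub>R v \<in> K" and "t \<in> {0..e}"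
  shows "((\<lambda>t. u (x + t *\<^sub>R v)) has_vector_derivative directional K u (x + t *\<^sub>R v) v)
           (at t within {0..e})"
proof -
  let ?\<gamma> = "\<lambda>t. x + t *\<^sub>R v"
  \<comment> \<open>The derivative within \<open>K\<close> is first restricted to the image of the
    segment, the set that the chain rule for derivatives within sets asks for.\<close>
  have "(u has_derivative directional K u (?\<gamma> t)) (at (?\<gamma> t) within ?\<gamma> ` {0..e})"
    using has_derivative_directional[OF assms(1) ray[OF assms(3)]]
    by (rule has_derivative_subset) (use ray in auto)
  moreover have "(?\<gamma> has_derivative (\<lambda>h. h *\<^sub>R v)) (at t within {0..e})"
    by (auto intro!: derivative_eq_intros)
  ultimately have "((\<lambda>t. u (?\<gamma> t)) has_derivative (\<lambda>h. directional K u (?\<gamma> t) (h *\<^sub>R v)))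
      (at t within {0..e})"
    by (rule has_derivative_in_compose[rotated])
  moreover have "directional K u (?\<gamma> t) (h *\<^sub>R v) = h *\<^sub>R directional K u (?\<gamma> t) v" for h
    by (simp add: directional_def scaleR_right.sum)
  ultimately show ?thesis
    by (simp add: has_vector_derivative_def)
qed

section \<open>One-sided derivative tests for a maximum at the left endpoint\<close>

lemma first_order_test_right:
  fixes g :: "real \<Rightarrow> real"
  assumes "e > 0" and "(g has_real_derivative d) (at 0 within {0..e})"
    and max: "\<And>t. t \<in> {0..e} \<Longrightarrow> g t \<le> g 0"
  shows "d \<le> 0"
proof (rule ccontr)
  assume "\<not> d \<le> 0"
  then obtain r where r: "r > 0" "\<And>h. h > 0 \<Longrightarrow> 0 + h \<in> {0..e} \<Longrightarrow> h < r \<Longrightarrow> g 0 < g (0 + h)"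
    using has_real_derivative_pos_inc_right[OF assms(2)] by force
  define h where "h = min e (r / 2)"
  have "h > 0" "h \<le> e" "h < r"
    using r(1) \<open>e > 0\<close> by (auto simp: h_def)
  then show False
    using r(2)[of h] max[of h] by auto
qed

text \<open>If \<open>d > 0\<close>, then \<open>g'\<close>, which vanishes at 0, is positive just
  to the right of 0, and the mean value theorem lifts \<open>g\<close> above \<open>g 0\<close>
  there.\<close>

lemma second_order_test_right:
  fixes g :: "real \<Rightarrow> real"
  assumes "e > 0" and g: "\<And>t. t \<in> {0..e} \<Longrightarrow> (g has_real_derivative g' t) (at t within {0..e})"
    and "g' 0 = 0" and "(g' has_real_derivative d) (at 0 within {0..e})"
    and max: "\<And>t. t \<in> {0..e} \<Longrightarrow> g t \<le> g 0"
  shows "d \<le> 0"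
proof (rule ccontr)
  assume "\<not> d \<le> 0"
  then obtain r where r: "r > 0" "\<And>h. h > 0 \<Longrightarrow> 0 + h \<in> {0..e} \<Longrightarrow> h < r \<Longrightarrow> g' 0 < g' (0 + h)"
    using has_real_derivative_pos_inc_right[OF assms(4)] by force
  define h where "h = min e (r / 2)"
  have h: "h > 0" "h \<le> e" "h < r"
    using r(1) \<open>e > 0\<close> by (auto simp: h_def)
  have "(g has_derivative (*) (g' t)) (at t within {0..h})" if "0 \<le> t" "t \<le> h" for t
    using has_field_derivative_subset[OF g[of t], of "{0..h}"] that h
    by (auto simp: has_field_derivative_def)
  then obtain t where t: "t \<in> {0<..<h}" "g h - g 0 = g' t * (h - 0)"
    using mvt_simple[OF h(1), of g "\<lambda>t. (*) (g' t)"] by blast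
  have "g' t > 0"
    using r(2)[of t] t(1) h \<open>g' 0 = 0\<close> by auto
  then have "g h > g 0"
    using t h by (smt (verit) mult_pos_pos)
  then show False
    using max[of h] h by auto
qed

section \<open>Maxima of the modulus\<close>

context
  fixes K :: "(real^'d::finite) set" and u :: "real^'d \<Rightarrow> 'b::real_inner" and x :: "real^'d"
  assumes Du: "u differentiable_on K" and x: "x \<in> K"
    and max: "\<And>y. y \<in> K \<Longrightarrow> norm (u y) \<le> norm (u x)"
begin

text \<open>The squared norm replaces the norm because it stays differentiable at zeros of
  \<open>u\<close>.\<close>

lemma norm_max_ray_derivative:
  assumes "\<And>t. t \<in> {0..e} \<Longrightarrow> x + t *\<^sub>R v \<in> K" and "t \<in> {0..e}"
  shows "((\<lambda>t. u (x + t *\<^sub>R v) \<bullet> u (x + t *\<^sub>R v)) has_real_derivative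
           2 * (u (x + t *\<^sub>R v) \<bullet> directional K u (x + t *\<^sub>R v) v)) (at t within {0..e})"
  using bounded_bilinear.has_vector_derivative[OF bounded_bilinear_inner
      has_vector_derivative_ray[OF Du assms] has_vector_derivative_ray[OF Du assms]]
  by (simp add: has_real_derivative_iff_has_vector_derivative inner_commute)

lemma inner_self_max: "y \<in> K \<Longrightarrow> u y \<bullet> u y \<le> u x \<bullet> u x"
  using max by (simp add: dot_square_norm)

lemma norm_max_first_order:
  assumes "e > 0" and ray: "\<And>t. t \<in> {0..e} \<Longrightarrow> x + t *\<^sub>R v \<in> K"
  shows "u x \<bullet> directional K u x v \<le> 0"
proof -
  have "2 * (u x \<bullet> directional K u x v) \<le> 0"
  proof (rule first_order_test_right[OF \<open>e > 0\<close>])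
    show "((\<lambda>t. u (x + t *\<^sub>R v) \<bullet> u (x + t *\<^sub>R v)) has_real_derivative
        2 * (u x \<bullet> directional K u x v)) (at 0 within {0..e})"
      using norm_max_ray_derivative[OF ray, where t=0] \<open>e > 0\<close> by simp
  qed (use inner_self_max ray in simp)
  then show ?thesis
    by simp
qed

text \<open>\<open>?Q\<close> is half the second derivative at 0 of the squared norm along the ray,
  and \<open>crit\<close> says that the first derivative vanishes there, so the one-sided
  second-order test applies.\<close>

lemma norm_max_second_order:
  assumes D2u: "\<And>i. partial K i u differentiable_on K"
    and "e > 0" and ray: "\<And>t. t \<in> {0..e} \<Longrightarrow> x + t *\<^sub>R v \<in> K"
    and crit: "u x \<bullet> directional K u x v = 0"
  shows "u x \<bullet> (\<Sum>i\<in>UNIV. v $ i *\<^sub>R directional K (partial K i u) x v)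
           + (norm (directional K u x v))\<^sup>2 \<le> 0" (is "?Q \<le> 0")
proof -
  have 0: "(0::real) \<in> {0..e}"
    using \<open>e > 0\<close> by simp
  have "((\<lambda>t. v $ i *\<^sub>R partial K i u (x + t *\<^sub>R v)) has_vector_derivative
      v $ i *\<^sub>R directional K (partial K i u) x v) (at 0 within {0..e})" for i
    using has_vector_derivative_ray[OF D2u[of i] ray 0]
    by (intro bounded_linear.has_vector_derivative[OF bounded_linear_scaleR_right]) auto
  then have "((\<lambda>t. directional K u (x + t *\<^sub>R v) v) has_vector_derivative
      (\<Sum>i\<in>UNIV. v $ i *\<^sub>R directional K (partial K i u) x v)) (at 0 within {0..e})"
    unfolding directional_def[of K u] by (intro has_vector_derivative_sum)
  note bounded_bilinear.has_vector_derivative[OF bounded_bilinear_inner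
      has_vector_derivative_ray[OF Du ray 0] this]
  then have "((\<lambda>t. u (x + t *\<^sub>R v) \<bullet> directional K u (x + t *\<^sub>R v) v) has_real_derivative ?Q)
      (at 0 within {0..e})"
    by (simp add: has_real_derivative_iff_has_vector_derivative dot_square_norm)
  from DERIV_cmult[OF this, of 2] have "2 * ?Q \<le> 0"
    by (intro second_order_test_right[OF \<open>e > 0\<close> norm_max_ray_derivative[OF ray]])
      (use inner_self_max ray crit in simp_all)
  then show ?thesis
    by simp
qed

text \<open>The hypotheses on \<open>\<nu>\<close> hold at an interior maximum with \<open>\<nu> = 0\<close> and at a boundary maximum
  with the outer normal.\<close>

lemma norm_max_second_partial:
  assumes D2u: "\<And>i. partial K i u differentiable_on K"
    and inward: "\<And>v. \<nu> = 0 \<or> v \<bullet> \<nu> < 0 \<Longrightarrow> \<exists>e>0. \<forall>t\<in>{0..e}. x + t *\<^sub>R v \<in> K"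
    and neumann: "directional K u x \<nu> = 0"
  shows "u x \<bullet> partial K k (partial K k u) x + (norm (partial K k u x))\<^sup>2 \<le> 0"
proof -
  interpret linear "directional K u x"
    using Du x by (rule directional_linear)
  \<comment> \<open>\<open>Q\<close> is the Hessian form of half the squared norm; \<open>I\<close>
    selects the directions whose rays start inside \<open>K\<close>.\<close>
  define Q where "Q v = u x \<bullet> (\<Sum>i\<in>UNIV. v $ i *\<^sub>R directional K (partial K i u) x v)
    + (norm (directional K u x v))\<^sup>2" for v
  define I where "I v \<longleftrightarrow> \<nu> = 0 \<or> v \<bullet> \<nu> < 0" for v
  have push: "I (v - s *\<^sub>R \<nu>)" if "v \<bullet> \<nu> < s * (\<nu> \<bullet> \<nu>) \<or> \<nu> = 0" for v s
    using that by (auto simp: I_def inner_diff_left)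
  have le: "u x \<bullet> directional K u x v \<le> 0" for v
  proof -
    \<comment> \<open>For \<nu> \<noteq> 0 the shifted vector has inner product -1 with \<nu>; for
      \<nu> = 0 every direction is in \<open>I\<close>. By \<open>neumann\<close> the shift does not
      change the directional derivative.\<close>
    have "I (v - ((v \<bullet> \<nu> + 1) / (\<nu> \<bullet> \<nu>)) *\<^sub>R \<nu>)"
      by (rule push) auto
    then obtain e where "e > 0" "\<forall>t\<in>{0..e}. x + t *\<^sub>R (v - ((v \<bullet> \<nu> + 1) / (\<nu> \<bullet> \<nu>)) *\<^sub>R \<nu>) \<in> K"
      using inward unfolding I_def by blast
    then show ?thesis
      using norm_max_first_order[of e "v - ((v \<bullet> \<nu> + 1) / (\<nu> \<bullet> \<nu>)) *\<^sub>R \<nu>"]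
      by (simp add: diff scaleR neumann)
  qed
  \<comment> \<open>\<open>le\<close> for \<open>v\<close> and \<open>- v\<close> together: the
    squared norm is critical in every direction, including those whose rays leave
    \<open>K\<close>.\<close>
  have crit: "u x \<bullet> directional K u x v = 0" for v
    using le[of v] le[of "- v"] by (simp add: neg)
  have Q_inward: "Q v \<le> 0" if v: "I v" for v
    using inward[of v] that norm_max_second_order[OF D2u _ _ crit] unfolding Q_def I_def by blast
  have Q_neg: "Q (- v) = Q v" for v
    by (simp add: Q_def neg directional_def sum_negf)
  have Q_cont: "continuous_on UNIV Q"
    unfolding Q_def by (intro continuous_intros continuous_on_directional)
  \<comment> \<open>A ray in a tangential direction may leave \<open>K\<close>, but the direction is
    a limit of inward ones.\<close>
  have "Q v \<le> 0" if "v \<bullet> \<nu> = 0" for v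
  proof (rule tendsto_upperbound)
    have "continuous_on UNIV (\<lambda>\<epsilon>::real. Q (v - \<epsilon> *\<^sub>R \<nu>))"
      by (intro continuous_on_compose2[OF Q_cont] continuous_intros) auto
    then show "((\<lambda>\<epsilon>. Q (v - \<epsilon> *\<^sub>R \<nu>)) \<longlongrightarrow> Q v) (at_right 0)"
      using continuous_on_tendsto_compose
      by (auto simp: continuous_on_def dest!: spec[of _ 0] intro: tendsto_mono[OF at_le])
    have "I (v - \<epsilon> *\<^sub>R \<nu>)" if "\<epsilon> > 0" for \<epsilon>
      by (rule push) (use that \<open>v \<bullet> \<nu> = 0\<close> in auto)
    then show "\<forall>\<^sub>F \<epsilon> in at_right 0. Q (v - \<epsilon> *\<^sub>R \<nu>) \<le> 0"
      using Q_inward by (auto simp: eventually_at_right_field intro!: exI[of _ 1])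
  qed simp
  \<comment> \<open>For an outward \<open>v\<close> the opposite direction is inward, and
    \<open>Q\<close> is even.\<close>
  then have "Q v \<le> 0" for v
    using Q_inward[of v] Q_inward[of "- v"] Q_neg[of v]
    by (cases "v \<bullet> \<nu>" "0::real" rule: linorder_cases) (auto simp: I_def)
  from this[of "axis k 1"] show ?thesis
    by (simp add: Q_def directional_axis sum_axis_scaleR)
qed

end

section \<open>Rays into a smooth domain\<close>

lemma smooth_onD:
  assumes "smooth_on K u"
  shows "continuous_on K u" "u differentiable_on K" "partial K i u differentiable_on K"
    "continuous_on K (partial K i u)" "continuous_on K (partial K j (partial K i u))"
proof -
  have "Ck_on 0 K u" "Ck_on (Suc (Suc 0)) K u"
    using assms unfolding smooth_on_def by blast+
  then show "continuous_on K u" "u differentiable_on K" "partial K i u differentiable_on K"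
    "continuous_on K (partial K i u)" "continuous_on K (partial K j (partial K i u))"
    by (simp_all add: differentiable_imp_continuous_on)
qed

lemma inward_ray_interior:
  fixes v x :: "'a::real_normed_vector"
  assumes "open \<Omega>" and "x \<in> \<Omega>"
  shows "\<exists>e>0. \<forall>t\<in>{0..e}. x + t *\<^sub>R v \<in> \<Omega>"
proof -
  have "((\<lambda>t. x + t *\<^sub>R v) \<longlongrightarrow> x + 0 *\<^sub>R v) (at_right (0::real))"
    by (intro tendsto_intros)
  then have "\<forall>\<^sub>F t in at_right (0::real). x + t *\<^sub>R v \<in> \<Omega>"
    using assms by (intro topological_tendstoD) auto
  then obtain b where b: "b > 0" "\<And>t. 0 < t \<Longrightarrow> t < b \<Longrightarrow> x + t *\<^sub>R v \<in> \<Omega>"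
    by (auto simp: eventually_at_right_field)
  have "x + t *\<^sub>R v \<in> \<Omega>" if "t \<in> {0..b/2}" for t
    using that b assms by (cases "t = 0") auto
  with b(1) show ?thesis
    by (intro exI[of _ "b/2"]) auto
qed

text \<open>The normal is a positive multiple of the gradient of a local defining function \<rho>,
  so \<rho> drops strictly at the start of the ray, from a value that is at most 0. Near
  \<open>x\<close>, negative \<rho> means membership in \<Omega>.\<close>

lemma inward_ray_boundary:
  fixes \<Omega> :: "(real^'d::finite) set"
  assumes "unit_outer_normal \<Omega> \<nu>" and x: "x \<in> frontier \<Omega>" and v: "v \<bullet> \<nu> x < 0"
  shows "\<exists>e>0. \<forall>t\<in>{0..e}. x + t *\<^sub>R v \<in> closure \<Omega>"
proof -
  obtain U \<rho> where \<rho>: "local_defining_function \<Omega> x U \<rho>" and \<nu>: "\<nu> x = sgn (gradient U \<rho> x)"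
    using assms(1) x unfolding unit_outer_normal_def by blast
  have U: "open U" "x \<in> U" "smooth_on U \<rho>" "\<Omega> \<inter> U = {x \<in> U. \<rho> x < 0}"
    using \<rho> unfolding local_defining_function_def by auto
  have "v \<bullet> gradient U \<rho> x < 0"
    using v by (simp add: \<nu> sgn_div_norm zero_less_mult_iff mult_less_0_iff)
  then have neg: "directional U \<rho> x v < 0"
    by (simp add: directional_def gradient_def inner_vec_def)
  obtain e where e: "e > 0" "\<And>t. t \<in> {0..e} \<Longrightarrow> x + t *\<^sub>R v \<in> U"
    using inward_ray_interior[OF U(1,2)] by blast
  have "((\<lambda>t. \<rho> (x + t *\<^sub>R v)) has_real_derivative directional U \<rho> x v) (at 0 within {0..e})"
    using has_vector_derivative_ray[OF smooth_onD(2)[OF U(3)] e(2), of e 0] e(1)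
    by (simp add: has_real_derivative_iff_has_vector_derivative)
  from has_real_derivative_neg_dec_right[OF this neg] obtain r where
    r: "r > 0" "\<And>h. h > 0 \<Longrightarrow> h \<in> {0..e} \<Longrightarrow> h < r \<Longrightarrow> \<rho> (x + h *\<^sub>R v) < \<rho> x"
    by auto
  \<comment> \<open>If \<rho> were positive at \<open>x\<close>, it would be positive on a
    neighbourhood, which would then miss \<Omega> although \<open>x\<close> is in its
    closure.\<close>
  have "\<rho> x \<le> 0"
  proof (rule ccontr)
    assume "\<not> \<rho> x \<le> 0"
    have "open (U \<inter> \<rho> -` {0<..})"
      using U(1) smooth_onD(1)[OF U(3)] by (intro continuous_open_preimage) auto
    moreover have "x \<in> U \<inter> \<rho> -` {0<..}"
      using U(2) \<open>\<not> \<rho> x \<le> 0\<close> by auto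
    moreover have "x \<in> closure \<Omega>"
      using x by (simp add: frontier_def)
    ultimately obtain y where "y \<in> \<Omega>" "y \<in> U" "\<rho> y > 0"
      unfolding closure_iff_nhds_not_empty by blast
    then show False
      using U(4) by force
  qed
  have "x + t *\<^sub>R v \<in> closure \<Omega>" if t: "t \<in> {0..min e (r / 2)}" for t
  proof (cases "t = 0")
    case True
    then show ?thesis
      using x by (simp add: frontier_def)
  next
    case False
    then have "\<rho> (x + t *\<^sub>R v) < 0"
      using r(2)[of t] t r(1) \<open>\<rho> x \<le> 0\<close> by auto
    then have "x + t *\<^sub>R v \<in> \<Omega> \<inter> U"
      using e(2)[of t] t U(4) by auto
    then show ?thesis
      using closure_subset by blast
  qed
  then show ?thesis
    using e(1) r(1) by (intro exI[of _ "min e (r / 2)"]) auto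
qed

section \<open>The maximum principle for one time step\<close>

text \<open>Mean value inequality on the convex half-line; the one-sided derivative at 0 covers the
  zeros of the order parameter.\<close>

lemma derivative_bounded_lipschitz:
  assumes "derivative_bounded g L" and "s \<ge> 0" and "t \<ge> 0"
  shows "\<bar>g s - g t\<bar> \<le> L * \<bar>s - t\<bar>"
proof -
  obtain D where D: "\<And>s. s \<ge> 0 \<Longrightarrow> (g has_real_derivative D s) (at s within {0..})"
    "\<And>s. s \<ge> 0 \<Longrightarrow> \<bar>D s\<bar> \<le> L"
    using assms(1) unfolding derivative_bounded_def by metis
  show ?thesis
    using field_differentiable_bound[of "{0..}" g D L s t] D assms(2,3) by auto
qed

section \<open>The magnetic Laplacian tested with \<psi>\<close>

lemma rcdot_gradient: "rcdot v (gradient K u x) = directional K u x v"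
  by (simp add: rcdot_def gradient_def directional_def scaleR_conv_of_real)

text \<open>The inner product on the complex numbers is the real part of one factor times the
  conjugate of the other. The divergence term drops out, being an imaginary multiple of \<psi>, and
  the rest completes a square in each coordinate. The bracket divided by
  \<open>\<kappa>\<^sup>2\<close> is half the second partial derivative of the squared
  modulus.\<close>

lemma inner_magnetic_laplacian:
  assumes "\<kappa> \<noteq> 0"
  shows "\<psi> x \<bullet> magnetic_laplacian \<kappa> K A \<psi> x =
    (\<Sum>i\<in>UNIV. (norm (\<i> / of_real \<kappa> * partial K i \<psi> x + of_real (A x $ i) * \<psi> x))\<^sup>2
      - (\<psi> x \<bullet> partial K i (partial K i \<psi>) x + (norm (partial K i \<psi> x))\<^sup>2) / \<kappa>\<^sup>2)"
proof -
  \<comment> \<open>Here \<open>z\<close>, \<open>p\<close>, \<open>q\<close>, \<open>a\<close>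
    stand for \<psi>, its first and second partial derivative, and a component of \<open>A\<close>.
    The squared norm of \<open>p\<close> cancels between the square and the bracket.\<close>
  have term_eq: "(norm (\<i> / of_real \<kappa> * p + of_real a * z))\<^sup>2 - (z \<bullet> q + (norm p)\<^sup>2) / \<kappa>\<^sup>2
      = - (z \<bullet> q) / \<kappa>\<^sup>2 + 2 / \<kappa> * (z \<bullet> (\<i> * (of_real a * p))) + a\<^sup>2 * (norm z)\<^sup>2" for p q z a
  proof -
    have "\<i> / of_real \<kappa> * p = Complex (- Im p / \<kappa>) (Re p / \<kappa>)"
      by (simp add: complex_eq_iff)
    then show ?thesis
      unfolding cmod_power2 inner_complex_def
      by (simp add: power2_eq_square add_divide_distrib diff_divide_distrib algebra_simps)
  qed
  have A: "(norm (A x))\<^sup>2 = (\<Sum>i\<in>UNIV. (A x $ i)\<^sup>2)"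
    unfolding power2_norm_eq_inner inner_vec_def by (simp add: power2_eq_square)
  have "\<psi> x \<bullet> magnetic_laplacian \<kappa> K A \<psi> x =
      - (\<psi> x \<bullet> laplacian K \<psi> x) / \<kappa>\<^sup>2
      + 2 / \<kappa> * (\<psi> x \<bullet> (\<i> * rcdot (A x) (gradient K \<psi> x))) + (norm (A x))\<^sup>2 * (norm (\<psi> x))\<^sup>2"
    using assms unfolding magnetic_laplacian_def cmod_power2
    by (simp add: inner_complex_def field_simps power2_eq_square)
  also have "\<dots> = (\<Sum>i\<in>UNIV. - (\<psi> x \<bullet> partial K i (partial K i \<psi>) x) / \<kappa>\<^sup>2
      + 2 / \<kappa> * (\<psi> x \<bullet> (\<i> * (of_real (A x $ i) * partial K i \<psi> x))) + (A x $ i)\<^sup>2 * (norm (\<psi> x))\<^sup>2)"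
    unfolding A laplacian_def rcdot_def gradient_def
    by (simp add: sum.distrib sum_subtractf inner_sum_right sum_distrib_left sum_distrib_right
        sum_divide_distrib sum_negf)
  finally show ?thesis
    by (simp only: term_eq)
qed

text \<open>One step from \<phi> to \<psi>, for any dimension and any nonlinearity with the stated
  bounds, so that it serves both d = 2 and d = 3.\<close>

lemma psi_step_bound:
  fixes \<Omega> :: "(real^'d::finite) set" and A :: "real^'d \<Rightarrow> real^'d" and \<phi> \<psi> :: "real^'d \<Rightarrow> complex"
  assumes "\<kappa> > 0" and "\<tau> > 0" and "L \<ge> 0" and "S \<ge> 2 * L"
    and \<Omega>: "smooth_bounded_domain \<Omega>" and \<nu>: "unit_outer_normal \<Omega> \<nu>"
    and f: "\<And>x. x \<in> \<Omega> \<Longrightarrow> f x 1 = 0" "\<And>x. x \<in> \<Omega> \<Longrightarrow> derivative_bounded (f x) L"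
    and A: "continuous_on (closure \<Omega>) A" and \<phi>: "continuous_on (closure \<Omega>) \<phi>"
    and \<psi>: "smooth_on (closure \<Omega>) \<psi>"
    and eq: "\<And>x. x \<in> \<Omega> \<Longrightarrow> (\<psi> x - \<phi> x) / of_real \<tau> + magnetic_laplacian \<kappa> (closure \<Omega>) A \<psi> x
        + of_real (f x ((norm (\<phi> x))\<^sup>2)) * \<psi> x + of_real S * (\<psi> x - \<phi> x) = 0"
    and neumann: "\<And>x. x \<in> frontier \<Omega> \<Longrightarrow> rcdot (\<nu> x) (gradient (closure \<Omega>) \<psi> x) = 0"
    and \<phi>_le: "\<And>x. x \<in> closure \<Omega> \<Longrightarrow> norm (\<phi> x) \<le> 1"
    and y: "y \<in> closure \<Omega>"
  shows "norm (\<psi> y) \<le> 1"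
proof (rule ccontr)
  assume "\<not> norm (\<psi> y) \<le> 1"
  let ?K = "closure \<Omega>"
  note \<psi>_smooth = smooth_onD[OF \<psi>]
  have "open \<Omega>" "compact ?K"
    using \<Omega> by (auto simp: smooth_bounded_domain_def compact_closure)
  obtain x where x: "x \<in> ?K" and max: "\<And>z. z \<in> ?K \<Longrightarrow> norm (\<psi> z) \<le> norm (\<psi> x)"
    using continuous_attains_sup[OF \<open>compact ?K\<close>, of "\<lambda>x. norm (\<psi> x)"] y \<psi>_smooth(1)
    by (metis continuous_on_norm empty_iff)
  \<comment> \<open>\<open>P\<close> gathers the terms without derivatives, with the nonlinearity
    replaced by its lower bound \<open>- S * (1 - norm (\<phi> z))\<close>; \<open>E\<close> is the
    tested magnetic Laplacian in completed-square form.\<close>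
  define P where "P z = (\<psi> z \<bullet> (\<psi> z - \<phi> z)) * (1 / \<tau> + S)
    - S * (1 - norm (\<phi> z)) * (norm (\<psi> z))\<^sup>2" for z
  define E where "E z = (\<Sum>i\<in>UNIV.
    (norm (\<i> / of_real \<kappa> * partial ?K i \<psi> z + of_real (A z $ i) * \<psi> z))\<^sup>2
      - (\<psi> z \<bullet> partial ?K i (partial ?K i \<psi>) z + (norm (partial ?K i \<psi> z))\<^sup>2) / \<kappa>\<^sup>2)" for z
  have PE: "P z + E z \<le> 0" if z: "z \<in> \<Omega>" for z
  proof -
    let ?a = "norm (\<phi> z)"
    have a: "?a \<le> 1"
      using \<phi>_le closure_subset z by blast
    have "\<bar>f z (?a\<^sup>2) - f z 1\<bar> \<le> L * \<bar>?a\<^sup>2 - 1\<bar>"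
      using derivative_bounded_lipschitz[OF f(2)[OF z]] by simp
    moreover have "?a\<^sup>2 \<le> 1"
      using a by (simp add: power_le_one)
    ultimately have "f z (?a\<^sup>2) \<ge> - (L * (1 - ?a\<^sup>2))"
      using f(1)[OF z] by (auto simp: abs_if split: if_splits)
    moreover have "L * (1 - ?a\<^sup>2) \<le> S * (1 - ?a)"
    proof -
      \<comment> \<open>The factor 2 in \<open>S \<ge> 2 * L\<close> comes from
        \<open>1 + ?a \<le> 2\<close> in this factorization.\<close>
      have "L * (1 - ?a\<^sup>2) = L * (1 + ?a) * (1 - ?a)"
        by (simp add: algebra_simps power2_eq_square)
      also have "L * (1 + ?a) \<le> L * 2"
        using a \<open>L \<ge> 0\<close> by (intro mult_left_mono) auto
      then have "L * (1 + ?a) * (1 - ?a) \<le> S * (1 - ?a)"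
        using a \<open>S \<ge> 2 * L\<close> by (intro mult_right_mono) auto
      finally show ?thesis .
    qed
    ultimately have "f z (?a\<^sup>2) \<ge> - (S * (1 - ?a))"
      by linarith
    then have le: "f z (?a\<^sup>2) * (norm (\<psi> z))\<^sup>2 \<ge> - (S * (1 - ?a)) * (norm (\<psi> z))\<^sup>2"
      by (rule mult_right_mono) simp
    have "0 = \<psi> z \<bullet> ((1 / \<tau>) *\<^sub>R (\<psi> z - \<phi> z) + magnetic_laplacian \<kappa> ?K A \<psi> z
        + f z (?a\<^sup>2) *\<^sub>R \<psi> z + S *\<^sub>R (\<psi> z - \<phi> z))"
      using eq[OF z] by (simp add: scaleR_conv_of_real divide_inverse mult.commute)
    also have "\<dots> = (\<psi> z \<bullet> (\<psi> z - \<phi> z)) * (1 / \<tau> + S) + E z + f z (?a\<^sup>2) * (norm (\<psi> z))\<^sup>2"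
      using inner_magnetic_laplacian[of \<kappa> \<psi> z ?K A] \<open>\<kappa> > 0\<close>
      unfolding E_def inner_add_right inner_scaleR_right dot_square_norm
      by (simp add: algebra_simps)
    finally show ?thesis
      using le by (simp add: P_def)
  qed
  have "continuous_on ?K A" "continuous_on ?K \<phi>" "continuous_on ?K \<psi>"
    using A \<phi> \<psi>_smooth(1) by auto
  \<comment> \<open>The scheme holds only in the open set \<Omega>, whereas the maximum may be
    attained on the frontier; continuity carries the inequality there.\<close>
  then have "continuous_on ?K (\<lambda>z. P z + E z)"
    unfolding P_def E_def using \<psi>_smooth(4,5) \<open>\<kappa> > 0\<close> by (intro continuous_intros) auto
  then have le0: "P x + E x \<le> 0"
    using continuous_le_on_closure[of \<Omega> "\<lambda>z. P z + E z" x 0] x PE by blast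
  obtain m where m: "\<And>v. m = 0 \<or> v \<bullet> m < 0 \<Longrightarrow> \<exists>e>0. \<forall>t\<in>{0..e}. x + t *\<^sub>R v \<in> ?K"
    "directional ?K \<psi> x m = 0"
  proof (cases "x \<in> \<Omega>")
    case True
    have "\<exists>e>0. \<forall>t\<in>{0..e}. x + t *\<^sub>R v \<in> ?K" for v
      using inward_ray_interior[OF \<open>open \<Omega>\<close> True] closure_subset by blast
    then show ?thesis
      using that[of 0] by (simp add: directional_def)
  next
    case False
    then have fr: "x \<in> frontier \<Omega>"
      using x \<open>open \<Omega>\<close> by (simp add: frontier_def interior_open)
    \<comment> \<open>A zero normal would require rays in all directions to stay in the closure; the
      nonvanishing gradient of the defining function excludes it.\<close>
    then have "\<nu> x \<noteq> 0"
      using \<nu> unfolding unit_outer_normal_def local_defining_function_def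
      by (metis sgn_zero_iff)
    then show ?thesis
      using that[of "\<nu> x"] inward_ray_boundary[OF \<nu> fr] neumann[OF fr] by (auto simp: rcdot_gradient)
  qed
  have "E x \<ge> 0"
    unfolding E_def
  proof (rule sum_nonneg)
    fix i
    have "\<psi> x \<bullet> partial ?K i (partial ?K i \<psi>) x + (norm (partial ?K i \<psi> x))\<^sup>2 \<le> 0"
      using norm_max_second_partial[OF \<psi>_smooth(2) x max \<psi>_smooth(3) m] .
    then have "(\<psi> x \<bullet> partial ?K i (partial ?K i \<psi>) x + (norm (partial ?K i \<psi> x))\<^sup>2) / \<kappa>\<^sup>2 \<le> 0"
      by (simp add: divide_le_0_iff)
    then show "0 \<le> (norm (\<i> / of_real \<kappa> * partial ?K i \<psi> x + of_real (A x $ i) * \<psi> x))\<^sup>2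
      - (\<psi> x \<bullet> partial ?K i (partial ?K i \<psi>) x + (norm (partial ?K i \<psi> x))\<^sup>2) / \<kappa>\<^sup>2"
      by (smt (verit) zero_le_power2)
  qed
  moreover have "P x > 0"
  proof -
    define a b where "a = norm (\<phi> x)" and "b = norm (\<psi> x)"
    have b: "b > 1"
      using max[OF y] \<open>\<not> norm (\<psi> y) \<le> 1\<close> by (simp add: b_def)
    have a: "0 \<le> a" "a \<le> 1"
      using \<phi>_le[OF x] by (auto simp: a_def)
    have S: "S \<ge> 0"
      using assms(3,4) by linarith
    have "\<psi> x \<bullet> \<phi> x \<le> b * a"
      unfolding a_def b_def by (rule norm_cauchy_schwarz)
    then have "\<psi> x \<bullet> (\<psi> x - \<phi> x) \<ge> b * (b - a)"
      by (simp add: inner_diff_right dot_square_norm b_def power2_eq_square algebra_simps)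
    then have "(\<psi> x \<bullet> (\<psi> x - \<phi> x)) * (1 / \<tau> + S) \<ge> b * (b - a) * (1 / \<tau> + S)"
      using S \<open>\<tau> > 0\<close> by (intro mult_right_mono) auto
    \<comment> \<open>The terms in \<open>S * b\<^sup>2\<close> cancel, and the stabilization leaves
      a nonnegative remainder. Strict positivity comes from the time difference, since
      \<open>b > 1\<close> and \<open>a \<le> 1\<close>.\<close>
    moreover have "b * (b - a) * (1 / \<tau> + S) - S * (1 - a) * b\<^sup>2
        = b * (b - a) / \<tau> + S * (a * b * (b - 1))"
      by (simp add: algebra_simps power2_eq_square diff_divide_distrib)
    moreover have "b * (b - a) / \<tau> > 0" "S * (a * b * (b - 1)) \<ge> 0"
      using a b S \<open>\<tau> > 0\<close> by auto
    ultimately show ?thesis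
      unfolding P_def a_def[symmetric] b_def[symmetric] by linarith
  qed
  ultimately show False
    using le0 by linarith
qed

section \<open>Induction over the time steps, and the two space dimensions\<close>

lemma psi_scheme_bound:
  fixes \<Omega> :: "(real^'d::finite) set"
  assumes "\<kappa> > 0" and "\<tau> > 0" and "L \<ge> 0" and "S \<ge> 2 * L"
    and "smooth_bounded_domain \<Omega>" and "unit_outer_normal \<Omega> \<nu>"
    and "\<forall>x\<in>closure \<Omega>. f x 1 = 0" and "\<forall>x\<in>closure \<Omega>. derivative_bounded (f x) L"
    and scheme: "psi_scheme \<Omega> \<nu> \<kappa> \<tau> S f \<psi> A" and A: "\<forall>n. smooth_on (closure \<Omega>) (A n)"
    and "\<forall>x\<in>closure \<Omega>. norm (\<psi> 0 x) \<le> 1"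
  shows "\<forall>x\<in>closure \<Omega>. norm (\<psi> n x) \<le> 1"
proof (induction n)
  case 0
  show ?case
    by fact
next
  case (Suc n)
  have \<psi>: "smooth_on (closure \<Omega>) (\<psi> m)" for m
    using scheme unfolding psi_scheme_def by blast
  have "x \<in> closure \<Omega>" if "x \<in> \<Omega>" for x
    using that closure_subset by blast
  \<comment> \<open>The scheme is read at index \<open>Suc n\<close>, so that its previous index is
    \<open>n\<close>, where the induction hypothesis gives the bound.\<close>
  moreover have "\<forall>x\<in>\<Omega>. (\<psi> (Suc n) x - \<psi> n x) / of_real \<tau>
      + magnetic_laplacian \<kappa> (closure \<Omega>) (A n) (\<psi> (Suc n)) x
      + of_real (f x ((norm (\<psi> n x))\<^sup>2)) * \<psi> (Suc n) x + of_real S * (\<psi> (Suc n) x - \<psi> n x) = 0"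
    "\<forall>x\<in>frontier \<Omega>. rcdot (\<nu> x) (gradient (closure \<Omega>) (\<psi> (Suc n)) x) = 0"
    using scheme unfolding psi_scheme_def by (metis One_nat_def diff_Suc_1 le_add1 plus_1_eq_Suc)+
  ultimately show ?case
    using psi_step_bound[OF assms(1-6), of f "A n" "\<psi> n" "\<psi> (Suc n)"]
      assms(7,8) Suc.IH smooth_onD(1)[OF \<psi>[of n]] \<psi>[of "Suc n"] A smooth_onD(1)[of _ "A n"]
    by blast
qed

theorem theorem3p1:
  fixes \<kappa> \<sigma> \<tau> S L \<omega> \<beta> \<beta>0 \<nu>0 :: real
  assumes "\<kappa> > 0" and "\<sigma> > 0" and "\<tau> > 0"
    and "\<omega> > 0" and "\<beta> > 0" and "\<beta>0 > 0"
    and "\<nu>0 * integral {0..\<omega>} (\<lambda>\<xi>. tanh (\<beta>0 * \<xi>) / (2 * \<xi>)) = 1"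
    and "L > 0" and "S \<ge> 2 * L"
  shows "(\<forall>(\<Omega> :: (real^2) set) (\<nu> :: real^2 \<Rightarrow> real^2) (\<delta> :: real^2 \<Rightarrow> real)
          (H :: real^2 \<Rightarrow> real \<Rightarrow> real) (\<psi> :: nat \<Rightarrow> real^2 \<Rightarrow> complex)
          (A :: nat \<Rightarrow> real^2 \<Rightarrow> real^2) (\<psi>0 :: real^2 \<Rightarrow> complex).
        smooth_bounded_domain \<Omega> \<longrightarrow>
        unit_outer_normal \<Omega> \<nu> \<longrightarrow>
        smooth_on (closure \<Omega>) \<delta> \<longrightarrow>
        (\<forall>x\<in>closure \<Omega>. gl_f \<nu>0 \<omega> \<beta> (\<delta> x) 1 = 0) \<longrightarrow>
        (\<forall>x\<in>closure \<Omega>. derivative_bounded (gl_f \<nu>0 \<omega> \<beta> (\<delta> x)) L) \<longrightarrow>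
        psi_scheme \<Omega> \<nu> \<kappa> \<tau> S (\<lambda>x. gl_f \<nu>0 \<omega> \<beta> (\<delta> x)) \<psi> A \<longrightarrow>
        A_scheme_2d \<Omega> \<nu> \<kappa> \<sigma> \<tau> H \<psi> A \<longrightarrow>
        (\<forall>x\<in>closure \<Omega>. \<psi> 0 x = \<psi>0 x) \<longrightarrow>
        (\<forall>x\<in>closure \<Omega>. norm (\<psi>0 x) \<le> 1) \<longrightarrow>
        (\<forall>n. \<forall>x\<in>closure \<Omega>. norm (\<psi> n x) \<le> 1))
    \<and>
     (\<forall>(\<Omega> :: (real^3) set) (\<nu> :: real^3 \<Rightarrow> real^3) (\<delta> :: real^3 \<Rightarrow> real)
          (H :: real^3 \<Rightarrow> real \<Rightarrow> real^3) (\<psi> :: nat \<Rightarrow> real^3 \<Rightarrow> complex)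
          (A :: nat \<Rightarrow> real^3 \<Rightarrow> real^3) (\<psi>0 :: real^3 \<Rightarrow> complex).
        smooth_bounded_domain \<Omega> \<longrightarrow>
        unit_outer_normal \<Omega> \<nu> \<longrightarrow>
        smooth_on (closure \<Omega>) \<delta> \<longrightarrow>
        (\<forall>x\<in>closure \<Omega>. gl_f \<nu>0 \<omega> \<beta> (\<delta> x) 1 = 0) \<longrightarrow>
        (\<forall>x\<in>closure \<Omega>. derivative_bounded (gl_f \<nu>0 \<omega> \<beta> (\<delta> x)) L) \<longrightarrow>
        psi_scheme \<Omega> \<nu> \<kappa> \<tau> S (\<lambda>x. gl_f \<nu>0 \<omega> \<beta> (\<delta> x)) \<psi> A \<longrightarrow>
        A_scheme_3d \<Omega> \<nu> \<kappa> \<sigma> \<tau> H \<psi> A \<longrightarrow>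
        (\<forall>x\<in>closure \<Omega>. \<psi> 0 x = \<psi>0 x) \<longrightarrow>
        (\<forall>x\<in>closure \<Omega>. norm (\<psi>0 x) \<le> 1) \<longrightarrow>
        (\<forall>n. \<forall>x\<in>closure \<Omega>. norm (\<psi> n x) \<le> 1))"
\<comment> \<open>Both dimensions reduce to \<open>psi_scheme_bound\<close>: the scheme for
  \<open>A\<close> supplies the smoothness of every \<open>A n\<close>, and the bound on
  \<open>\<psi>0\<close> passes to \<open>\<psi> 0\<close> on the closure.\<close>
proof (intro conjI allI impI, goal_cases)
  case (1 \<Omega> \<nu> \<delta> H \<psi> A \<psi>0)
  then show ?case
    using psi_scheme_bound[OF assms(1,3) less_imp_le[OF assms(8)] assms(9) 1(1,2,4,5,6)]
    by (simp add: A_scheme_2d_def)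
next
  case (2 \<Omega> \<nu> \<delta> H \<psi> A \<psi>0)
  then show ?case
    using psi_scheme_bound[OF assms(1,3) less_imp_le[OF assms(8)] assms(9) 2(1,2,4,5,6)]
    by (simp add: A_scheme_3d_def)
qed

end
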